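(* Let $u$ and $v$ be vertices of a $2$-connected graph $G$. Then the diameter of the $uv$ path graph $\mathcal{P}(G_{uv})$ is at most $2d_G(u,v)$, where $d_G(u,v)$ is the length of a shortest path joining $u$ and $v$ in $G$.
   Context: For a path $L$ and vertices $x,y$ on $L$, $L_{xy}$ denotes the subpath of $L$ joining $x$ and $y$. For vertices $u,v$ of a $2$-connected graph $G$, the $uv$ path graph $\mathcal{P}(G_{uv})$ is the graph whose vertices are the paths in $G$ joining $u$ and $v$, where two such paths $S$ and $T$ are adjacent if $T$ is obtained from $S$ by replacing a subpath $S_{xy}$ of $S$ with a subpath $T_{xy}$ of $T$ that is internally disjoint from $S_{xy}$. The diameter of a connected graph is the maximum distance between pairs of its vertices. *)

theory Defs
  imports "Graph_Theory.Graph_Theory" "HOL-Library.Extended_Nat"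
begin

text \<open>
  A simple graph is a symmetric loop-free digraph whose arcs are pairs of vertices
  (\<^locale>\<open>pair_bidirected_digraph\<close>). Finiteness is not assumed. A path is represented by the
  list of its vertices, read from \<open>u\<close> to \<open>v\<close>.
\<close>

definition two_connected :: "'a pair_pre_digraph \<Rightarrow> bool" where
  "two_connected G \<longleftrightarrow>
     (\<exists>A \<subseteq> pverts G. card A = 3) \<and>
     connected (with_proj G) \<and>
     (\<forall>x \<in> pverts G. connected (pre_digraph.del_vert (with_proj G) x))"

definition paths_between :: "'a pair_pre_digraph \<Rightarrow> 'a \<Rightarrow> 'a \<Rightarrow> 'a list set" where
  "paths_between G u v = {p. vpath p (with_proj G) \<and> hd p = u \<and> last p = v}"

text \<open>
  Distance and diameter take values in \<^typ>\<open>enat\<close>: the distance is \<open>\<infinity>\<close> if there is no joining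
  path, so a finite bound on the diameter of a graph includes its connectedness.
\<close>

definition graph_dist :: "'a pair_pre_digraph \<Rightarrow> 'a \<Rightarrow> 'a \<Rightarrow> enat" where
  "graph_dist G u v = (INF p \<in> paths_between G u v. enat (vwalk_length p))"

definition graph_diameter :: "'a pair_pre_digraph \<Rightarrow> enat" where
  "graph_diameter G = (SUP (x, y) \<in> pverts G \<times> pverts G. graph_dist G x y)"

text \<open>
  Below, \<open>A @ [x]\<close> and \<open>y # B\<close> are the parts of \<open>S\<close> kept in \<open>T\<close>, and \<open>P\<close>, \<open>Q\<close> are the lists of
  internal vertices of the subpaths $S_{xy}$ and $T_{xy}$.
\<close>

definition subpath_replacement :: "'a list \<Rightarrow> 'a list \<Rightarrow> bool" where
  "subpath_replacement S T \<longleftrightarrow>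
     (\<exists>A x P Q y B. S = A @ [x] @ P @ [y] @ B \<and> T = A @ [x] @ Q @ [y] @ B \<and>
        set P \<inter> set Q = {})"

text \<open>
  The condition \<open>S \<noteq> T\<close> only excludes the loops that would arise from replacing an edge by itself.
\<close>

definition path_graph :: "'a pair_pre_digraph \<Rightarrow> 'a \<Rightarrow> 'a \<Rightarrow> 'a list pair_pre_digraph" where
  "path_graph G u v =
     \<lparr>pverts = paths_between G u v,
      parcs = {(S, T). S \<in> paths_between G u v \<and> T \<in> paths_between G u v \<and>
                       S \<noteq> T \<and> subpath_replacement S T}\<rparr>"

lemma subpath_replacement_sym: "subpath_replacement S T \<Longrightarrow> subpath_replacement T S"
  unfolding subpath_replacement_def by (metis Int_commute)

lemma pair_bidirected_digraph_path_graph: "pair_bidirected_digraph (path_graph G u v)"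
  by unfold_locales
    (auto simp: path_graph_def symmetric_def sym_def intro: subpath_replacement_sym)

end

theory Submission
  imports Defs
begin

text \<open>
  Fix any \<open>uv\<close> path \<open>L\<close>. A path \<open>S\<close> agreeing with \<open>L\<close> up to a vertex \<open>x \<noteq> v\<close> is rerouted in one
  replacement: follow \<open>L\<close> beyond \<open>x\<close> until it first meets the rest of \<open>S\<close> again, at \<open>y\<close>, and then
  continue along \<open>S\<close>. The new path agrees with \<open>L\<close> at least one edge further, so \<open>S\<close> reaches \<open>L\<close>
  after at most as many replacements as \<open>L\<close> has edges. For \<open>L\<close> a shortest path, any two
  \<open>uv\<close> paths are then joined through \<open>L\<close> by a walk of length at most \<open>2 * d(u, v)\<close>.
\<close>

lemma length_vwalk_to_vpath_le: "length (vwalk_to_vpath p) \<le> length p"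
proof (induct p rule: vwalk_to_vpath_induct3)
  case (in_set x xs)
  then show ?case
    using length_dropWhile_le[of "\<lambda>y. y \<noteq> x" xs] by simp
qed auto

text \<open>\<open>graph_dist\<close> ranges over paths only, but cutting the cycles out of a walk
  keeps its ends and does not lengthen it.\<close>

lemma graph_dist_le_vwalk_length:
  assumes "vwalk p (with_proj G)" "hd p = u" "last p = v"
  shows "graph_dist G u v \<le> enat (vwalk_length p)"
proof -
  have "vwalk_to_vpath p \<in> paths_between G u v"
    using assms
    by (simp add: paths_between_def vwalk_to_vpath_vpath vwalk_to_vpath_hd vwalk_to_vpath_last)
  then have "graph_dist G u v \<le> enat (vwalk_length (vwalk_to_vpath p))"
    unfolding graph_dist_def by (rule INF_lower)
  also have "\<dots> \<le> enat (vwalk_length p)"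
    using length_vwalk_to_vpath_le[of p] by simp
  finally show ?thesis .
qed

lemma graph_dist_attained:
  assumes "paths_between G u v \<noteq> {}"
  obtains p where "p \<in> paths_between G u v" "graph_dist G u v = enat (vwalk_length p)"
proof -
  let ?lengths = "(\<lambda>p. enat (vwalk_length p)) ` paths_between G u v"
  have "Inf ?lengths \<in> ?lengths"
    using assms by (auto simp: Inf_enat_def intro: LeastI)
  then show thesis
    using that unfolding graph_dist_def by auto
qed

text \<open>The two walks are glued at \<open>y\<close>. For distinctness, \<open>S\<close>
  separates \<open>B\<close> from \<open>C\<close>, \<open>x\<close> and \<open>y\<close>, and
  \<open>L\<close> separates \<open>Q\<close> from them; only \<open>Q\<close> against
  \<open>B\<close> has to be assumed.\<close>

lemma reroute_in_paths_between:
  assumes S: "C @ x # P @ y # B \<in> paths_between G u v"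
    and L: "C @ x # Q @ y # D \<in> paths_between G u v"
    and disj: "set Q \<inter> set B = {}"
  shows "C @ x # Q @ y # B \<in> paths_between G u v"
proof -
  have "vwalk (y # B) (with_proj G)"
    using S vwalkI_append_r[of "y # B" "C @ x # P"]
    by (auto simp: paths_between_def)
  moreover have "vwalk (C @ x # Q @ [y]) (with_proj G)"
    using L vwalkI_append_l[of "C @ x # Q @ [y]" D]
    by (auto simp: paths_between_def)
  ultimately have "vwalk (C @ x # Q @ y # B) (with_proj G)"
    using vwalk_joinI_vwalk'[of "C @ x # Q @ [y]" "with_proj G" "y # B"]
    by (simp add: vwalk_join_def)
  moreover have "distinct (C @ x # Q @ y # B)"
    using S L disj by (auto simp: paths_between_def vpath_def)
  moreover have "hd (C @ x # Q @ y # B) = u"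
    using L by (cases C) (auto simp: paths_between_def)
  moreover have "last (C @ x # Q @ y # B) = v"
    using S by (auto simp: paths_between_def)
  ultimately show ?thesis
    by (auto simp: paths_between_def)
qed

text \<open>\<open>length D\<close> counts the edges of the target path beyond \<open>x\<close>. The
  prefix stays arbitrary in the induction on this number because each replacement extends
  it.\<close>

lemma path_graph_vwalk_to_common_prefix:
  assumes "C @ x # R \<in> paths_between G u v" "C @ x # D \<in> paths_between G u v"
  shows "\<exists>w. vwalk w (with_proj (path_graph G u v)) \<and> hd w = C @ x # R \<and>
    last w = C @ x # D \<and> vwalk_length w \<le> length D"
  using assms
proof (induction "length D" arbitrary: C x R D rule: less_induct)
  case less
  let ?S = "C @ x # R" and ?H = "with_proj (path_graph G u v)"
  show ?case
  proof (cases "R = [] \<or> D = []")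
    case True
    \<comment> \<open>If one tail is empty then \<open>x = v\<close>; a nonempty other tail would
      end in \<open>v\<close> and so repeat \<open>x\<close>.\<close>
    have "R = D"
      using True less.prems
      by (cases R rule: rev_cases; cases D rule: rev_cases) (auto simp: paths_between_def vpath_def)
    then show ?thesis
      using less.prems by (intro exI[of _ "[?S]"]) (auto simp: path_graph_def)
  next
    case False
    \<comment> \<open>Both tails end in \<open>v\<close>, so a first meeting vertex \<open>y\<close>
      exists.\<close>
    then have "last D = last R"
      using less.prems by (simp add: paths_between_def)
    then have "\<exists>y\<in>set D. y \<in> set R"
      using False by (metis last_in_set)
    then obtain Q y E where D: "D = Q @ y # E" and y: "y \<in> set R"
      and first: "\<forall>z\<in>set Q. z \<notin> set R"
      by (rule split_list_first_propE)
    obtain P B where R: "R = P @ y # B"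
      using y by (auto dest: split_list)
    let ?S' = "C @ x # Q @ y # B"
    have S': "?S' \<in> paths_between G u v"
    proof (rule reroute_in_paths_between)
      show "C @ x # P @ y # B \<in> paths_between G u v" "C @ x # Q @ y # E \<in> paths_between G u v"
        using less.prems unfolding R D by simp_all
      show "set Q \<inter> set B = {}"
        using first R by auto
    qed
    \<comment> \<open>The induction hypothesis is used with prefix \<open>C @ x # Q\<close> and
      branching vertex \<open>y\<close>.\<close>
    have "\<exists>w. vwalk w ?H \<and> hd w = (C @ x # Q) @ y # B \<and> last w = (C @ x # Q) @ y # E \<and>
        vwalk_length w \<le> length E"
      using S' less.prems(2) D by (intro less.hyps) simp_all
    then obtain w where w: "vwalk w ?H" "hd w = ?S'" "last w = C @ x # D"
        "vwalk_length w \<le> length E"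
      by (elim exE conjE) (simp add: D)
    \<comment> \<open>Equality means \<open>P = Q = []\<close>: both paths already use the edge from
      \<open>x\<close> to \<open>y\<close>. As \<open>path_graph\<close> has no loops, no move is
      made then.\<close>
    show ?thesis
    proof (cases "?S = ?S'")
      case True
      then show ?thesis
        using w D by (intro exI[of _ w]) simp
    next
      case False
      have "?S = C @ [x] @ P @ [y] @ B" "?S' = C @ [x] @ Q @ [y] @ B" "set P \<inter> set Q = {}"
        using first R by auto
      then have "subpath_replacement ?S ?S'"
        unfolding subpath_replacement_def by metis
      then have "vwalk (?S # w) ?H"
        using w(1,2) S' less.prems(1) False
        by (intro vwalk_consI) (simp_all add: path_graph_def)
      moreover have "w \<noteq> []"
        using w(1) by (simp add: vwalk_def)
      ultimately show ?thesis
        \<comment> \<open>The extra move is paid for by \<open>y\<close>, which lies in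
          \<open>D\<close> but not in \<open>E\<close>.\<close>
        using w D by (intro exI[of _ "?S # w"]) simp
    qed
  qed
qed

lemma path_graph_vwalk_to:
  assumes "S \<in> paths_between G u v" "L \<in> paths_between G u v"
  obtains w where "vwalk w (with_proj (path_graph G u v))" "hd w = S" "last w = L"
    "vwalk_length w \<le> vwalk_length L"
proof -
  \<comment> \<open>Both paths start at \<open>u\<close>, so the common prefix may be taken to be
    \<open>u\<close> alone.\<close>
  obtain R where S: "S = [] @ u # R"
    using assms(1) by (cases S) (auto simp: paths_between_def)
  obtain D where L: "L = [] @ u # D"
    using assms(2) by (cases L) (auto simp: paths_between_def)
  show thesis
    using path_graph_vwalk_to_common_prefix[OF assms[unfolded S L]]
    by (elim exE conjE, intro that) (simp_all add: S L)
qed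

theorem theorem2:
  fixes G :: "'a pair_pre_digraph" and u v :: 'a
  assumes "pair_bidirected_digraph G"
    and "two_connected G"
    and "u \<in> pverts G" and "v \<in> pverts G"
  shows "graph_diameter (path_graph G u v) \<le> 2 * graph_dist G u v"
proof -
  let ?H = "path_graph G u v"
  interpret H: pair_bidirected_digraph ?H
    by (rule pair_bidirected_digraph_path_graph)
  have "graph_dist ?H S T \<le> 2 * graph_dist G u v"
    if S: "S \<in> paths_between G u v" and T: "T \<in> paths_between G u v" for S T
  proof -
    have "paths_between G u v \<noteq> {}"
      using S by blast
    then obtain L where
      L: "L \<in> paths_between G u v" "graph_dist G u v = enat (vwalk_length L)"
      by (rule graph_dist_attained)
    obtain p where p: "vwalk p ?H" "hd p = S" "last p = L" "vwalk_length p \<le> vwalk_length L"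
      using path_graph_vwalk_to[OF S L(1)] .
    obtain q where q: "vwalk q ?H" "hd q = T" "last q = L" "vwalk_length q \<le> vwalk_length L"
      using path_graph_vwalk_to[OF T L(1)] .
    \<comment> \<open>Replacements are symmetric, so the walk from \<open>T\<close> to
      \<open>L\<close> can be run backwards.\<close>
    have "vwalk (rev q) ?H"
      using H.sym_arcs q(1) by (rule vwalk_rev_ex)
    moreover have join: "joinable p (rev q)"
      using p q by (simp add: vwalk_def hd_rev)
    ultimately have "vwalk (p \<oplus> rev q) ?H"
      using p(1) by (intro vwalk_joinI_vwalk)
    then have "graph_dist ?H S T \<le> enat (vwalk_length (p \<oplus> rev q))"
      using join p q
      by (intro graph_dist_le_vwalk_length) (simp_all add: vwalk_join_hd vwalk_join_last last_rev)
    also have "\<dots> \<le> enat (2 * vwalk_length L)"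
      using p(4) q(4) vwalk_join_vwalk_length[OF join] by simp
    also have "\<dots> = 2 * graph_dist G u v"
      unfolding L(2) numeral_eq_enat by simp
    finally show ?thesis .
  qed
  then show ?thesis
    unfolding graph_diameter_def by (auto intro!: SUP_least simp: path_graph_def)
qed

end
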